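(* Consider the linear program $$(LP)\qquad \inf_{x_1,\ldots,x_T}\ \sum_{t=1}^{T} f_t(x_t,x_{t-1}),\quad f_t(x_t,x_{t-1}):=c_t^\top x_t+d_t^\top x_{t-1},\quad\text{s.t. } x_t\in\mathcal{X}_t,\ A_tx_t+B_tx_{t-1}=b_t,\ t=1,\ldots,T,$$ with $x_0$ given. To solve $(LP)$, consider the Dual Dynamic Programming (DDP) algorithm combined with the Territory algorithm, Level 1 cut selection, or limited memory Level 1 cut selection (all described in the context). Consider the sequences of vectors $x_t^k$ and functions $\mathcal{Q}_t^k$ generated by this algorithm. Setting $\mathcal{X}_0=\{x_0\}$, assume that for $t=1,\ldots,T$, $\mathcal{X}_t$ is a nonempty, convex, compact polytope and that for every $x_{t-1}\in\mathcal{X}_{t-1}$ there exists $x_t\in\mathcal{X}_t$ such that $A_tx_t+B_tx_{t-1}=b_t$. Assume also that (H3) the linear subproblems solved along the iterations of DDP are solved using an algorithm that necessarily outputs a vertex as an optimal solution (for instance a simplex algorithm). Then there exists an integer $k_0\ge1$ such that (i) for every $k\ge k_0-1$ and every $t=2,\ldots,T$, we have $\mathcal{Q}_t^k=\mathcal{Q}_t^{k_0-1}$; (ii) $(x_1^{k_0},\ldots,x_T^{k_0})$ is an optimal solution to $(LP)$.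
   Context: Data. $x_0\in\mathbb{R}^n$, $c_t,d_t\in\mathbb{R}^n$, $\mathcal{X}_t\subset\mathbb{R}^n$, and $A_t,B_t,b_t$ are matrices and vectors of compatible sizes. DDP algorithm. The algorithm builds functions $\mathcal{Q}_t^k$, $k=0,1,2,\ldots$. For $t=T+1$, $\mathcal{Q}_{T+1}^k\equiv0$ for all $k$. For $t=2,\ldots,T$, $\mathcal{S}_t^0=\{0\}$ and $\mathcal{Q}_t^0=\mathcal{C}_t^0\equiv-\infty$. At iteration $k\ge1$, given the functions $\mathcal{Q}_t^{k-1}$, define for $t=1,\ldots,T$ $$\underline{\mathcal{Q}}_t^k(x_{t-1})=\inf_{x}\{f_t(x,x_{t-1})+\mathcal{Q}_{t+1}^{k-1}(x):\ x\in\mathcal{X}_t,\ A_tx+B_tx_{t-1}=b_t\}.$$ In a forward pass starting from $x_0^k=x_0$, compute successively for $t=1,\ldots,T$ an optimal solution $x_t^k$ of the problem defining $\underline{\mathcal{Q}}_t^k(x_{t-1}^k)$; these are the linear subproblems referred to in (H3). (If $\mathcal{Q}_{t+1}^{k-1}\equiv-\infty$, any feasible point counts as optimal.) For $t=2,\ldots,T$, set $\theta_t^k=\underline{\mathcal{Q}}_t^k(x_{t-1}^k)$, take a subgradient $\beta_t^k\in\partial\underline{\mathcal{Q}}_t^k(x_{t-1}^k)$, and define the cut $\mathcal{C}_t^k(x_{t-1})=\theta_t^k+\langle\beta_t^k,x_{t-1}-x_{t-1}^k\rangle$ (with the convention $\mathcal{C}_t^k\equiv-\infty$ if $\theta_t^k=-\infty$).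 Then a set $\mathcal{S}_t^k\subset\{0,1,\ldots,k\}$ of cut indices is selected and $\mathcal{Q}_t^k(x_{t-1})=\max_{\ell\in\mathcal{S}_t^k}\mathcal{C}_t^\ell(x_{t-1})$. Cut selection strategies. In all three cases $\mathcal{S}_t^k=\bigcup_{i=1}^k I_{t,i}^k$ for $k\ge1$, $t=2,\ldots,T$, where: - Level 1: $I_{t,i}^k=\operatorname{arg\,max}_{\ell=1,\ldots,k}\mathcal{C}_t^\ell(x_{t-1}^i)$ (the set of all maximizers); - Territory algorithm: $I_{t,i}^k=\operatorname{arg\,max}_{\ell\in\mathcal{S}_t^{k-1}\cup\{k\}}\mathcal{C}_t^\ell(x_{t-1}^i)$ (the set of all maximizers), starting from $\mathcal{S}_t^0=\{0\}$; - limited memory Level 1: $I_{t,i}^k$ is the singleton consisting of the smallest index (the oldest cut) in $\operatorname{arg\,max}_{\ell=1,\ldots,k}\mathcal{C}_t^\ell(x_{t-1}^i)$.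
   Formalization: (H3) is taken to cover dual solutions too: each subgradient β_t^k must come from an optimal basic (vertex) dual solution of the subproblem, as simplex gives; with arbitrary subgradients (i) can fail for Level 1 and Territory. *)

theory Defs
  imports "HOL-Analysis.Analysis"
begin

section \<open>The multistage linear program\<close>

text \<open>
  \<open>t\<close> is the stage. The matrices are given by their rows, so that the number
  \<open>nrows t\<close> of coupling constraints may depend on the stage: row \<open>i < nrows t\<close> of \<open>A\<^sub>t\<close>,
  \<open>B\<^sub>t\<close>, \<open>b\<^sub>t\<close> is \<open>A_row t i\<close>, \<open>B_row t i\<close>, \<open>b_rhs t i\<close>.
\<close>

record ('n::finite) lp_data =
  stages :: nat
  x_init :: "real ^ 'n"
  c_vec :: "nat \<Rightarrow> real ^ 'n"
  d_vec :: "nat \<Rightarrow> real ^ 'n"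
  X_set :: "nat \<Rightarrow> (real ^ 'n) set"
  nrows :: "nat \<Rightarrow> nat"
  A_row :: "nat \<Rightarrow> nat \<Rightarrow> real ^ 'n"
  B_row :: "nat \<Rightarrow> nat \<Rightarrow> real ^ 'n"
  b_rhs :: "nat \<Rightarrow> nat \<Rightarrow> real"

definition stage_cost :: "('n::finite) lp_data \<Rightarrow> nat \<Rightarrow> real ^ 'n \<Rightarrow> real ^ 'n \<Rightarrow> real" where
  "stage_cost P t x y = c_vec P t \<bullet> x + d_vec P t \<bullet> y"

definition stage_feasible :: "('n::finite) lp_data \<Rightarrow> nat \<Rightarrow> real ^ 'n \<Rightarrow> (real ^ 'n) set" where
  "stage_feasible P t y =
     {x \<in> X_set P t. \<forall>i<nrows P t. A_row P t i \<bullet> x + B_row P t i \<bullet> y = b_rhs P t i}"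

text \<open>A policy is a function of the stage; only its values at \<open>0, \<dots>, T\<close> matter.\<close>

definition lp_feasible :: "('n::finite) lp_data \<Rightarrow> (nat \<Rightarrow> real ^ 'n) \<Rightarrow> bool" where
  "lp_feasible P u \<longleftrightarrow>
     u 0 = x_init P \<and> (\<forall>t\<in>{1..stages P}. u t \<in> stage_feasible P t (u (t - 1)))"

definition lp_cost :: "('n::finite) lp_data \<Rightarrow> (nat \<Rightarrow> real ^ 'n) \<Rightarrow> real" where
  "lp_cost P u = (\<Sum>t=1..stages P. stage_cost P t (u t) (u (t - 1)))"

definition lp_optimal :: "('n::finite) lp_data \<Rightarrow> (nat \<Rightarrow> real ^ 'n) \<Rightarrow> bool" where
  "lp_optimal P u \<longleftrightarrow> is_arg_min (lp_cost P) (lp_feasible P) u"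


section \<open>Dual Dynamic Programming with cut selection\<close>

text \<open>Stage value function when the cost-to-go of the next stage is replaced by \<open>\<phi>\<close>.\<close>

definition stage_value ::
  "('n::finite) lp_data \<Rightarrow> nat \<Rightarrow> (real ^ 'n \<Rightarrow> ereal) \<Rightarrow> real ^ 'n \<Rightarrow> ereal" where
  "stage_value P t \<phi> y = (INF x\<in>stage_feasible P t y. ereal (stage_cost P t x y) + \<phi> x)"

text \<open>If \<open>\<phi>\<close> is constantly \<open>-\<infinity>\<close>, this holds for every feasible \<open>x\<close>.\<close>

definition stage_optimal ::
  "('n::finite) lp_data \<Rightarrow> nat \<Rightarrow> (real ^ 'n \<Rightarrow> ereal) \<Rightarrow> real ^ 'n \<Rightarrow> real ^ 'n \<Rightarrow> bool" where
  "stage_optimal P t \<phi> y x \<longleftrightarrow>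
     x \<in> stage_feasible P t y \<and> ereal (stage_cost P t x y) + \<phi> x = stage_value P t \<phi> y"

definition is_subgradient :: "(real ^ 'n \<Rightarrow> ereal) \<Rightarrow> real ^ 'n \<Rightarrow> real ^ 'n \<Rightarrow> bool" where
  "is_subgradient g y s \<longleftrightarrow> (\<forall>z. g y + ereal (s \<bullet> (z - y)) \<le> g z)"

datatype selection_strategy = Level1 | Territory | LimitedMemoryLevel1

text \<open>
  The set \<open>I\<^sub>t\<^sub>,\<^sub>i\<^sup>k\<close>, where \<open>v l\<close> is the value of cut \<open>l\<close> at the \<open>i\<close>-th trial point
  and \<open>S\<close> is the previous index set \<open>S\<^sub>t\<^sup>k\<^sup>-\<^sup>1\<close>.
\<close>

fun selected :: "selection_strategy \<Rightarrow> nat set \<Rightarrow> nat \<Rightarrow> (nat \<Rightarrow> ereal) \<Rightarrow> nat set" where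
  "selected Level1 S k v = {l. is_arg_max v (\<lambda>l. l \<in> {1..k}) l}"
| "selected Territory S k v = {l. is_arg_max v (\<lambda>l. l \<in> S \<union> {k}) l}"
| "selected LimitedMemoryLevel1 S k v = {Min {l. is_arg_max v (\<lambda>l. l \<in> {1..k}) l}}"

text \<open>
  All fields take the stage \<open>t\<close> first and the iteration \<open>k\<close> second:
  \<open>trial\<close> is \<open>x\<^sub>t\<^sup>k\<close>, \<open>theta\<close> is \<open>\<theta>\<^sub>t\<^sup>k\<close>, \<open>slope\<close> is \<open>\<beta>\<^sub>t\<^sup>k\<close>,
  \<open>cut\<close> is \<open>C\<^sub>t\<^sup>k\<close>, \<open>sel\<close> is \<open>S\<^sub>t\<^sup>k\<close> and \<open>approx\<close> is \<open>Q\<^sub>t\<^sup>k\<close>.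
\<close>

record ('n::finite) ddp_seq =
  trial :: "nat \<Rightarrow> nat \<Rightarrow> real ^ 'n"
  theta :: "nat \<Rightarrow> nat \<Rightarrow> ereal"
  slope :: "nat \<Rightarrow> nat \<Rightarrow> real ^ 'n"
  cut :: "nat \<Rightarrow> nat \<Rightarrow> real ^ 'n \<Rightarrow> ereal"
  sel :: "nat \<Rightarrow> nat \<Rightarrow> nat set"
  approx :: "nat \<Rightarrow> nat \<Rightarrow> real ^ 'n \<Rightarrow> ereal"

text \<open>
  In \<^typ>\<open>ereal\<close>, the formula for the cut yields the constant \<open>-\<infinity>\<close> when \<open>\<theta>\<^sub>t\<^sup>k = -\<infinity>\<close>,
  and every vector is then a subgradient.
\<close>

definition ddp_run ::
  "('n::finite) lp_data \<Rightarrow> selection_strategy \<Rightarrow> 'n ddp_seq \<Rightarrow> bool" where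
  "ddp_run P strategy R \<longleftrightarrow>
     (\<forall>k. approx R (stages P + 1) k = (\<lambda>_. 0)) \<and>
     (\<forall>t\<in>{2..stages P}. sel R t 0 = {0} \<and> cut R t 0 = (\<lambda>_. -\<infinity>) \<and> approx R t 0 = (\<lambda>_. -\<infinity>)) \<and>
     (\<forall>k\<ge>1.
        trial R 0 k = x_init P \<and>
        (\<forall>t\<in>{1..stages P}.
           stage_optimal P t (approx R (t + 1) (k - 1)) (trial R (t - 1) k) (trial R t k)) \<and>
        (\<forall>t\<in>{2..stages P}.
           theta R t k = stage_value P t (approx R (t + 1) (k - 1)) (trial R (t - 1) k) \<and>
           is_subgradient (stage_value P t (approx R (t + 1) (k - 1)))
             (trial R (t - 1) k) (slope R t k) \<and>
           cut R t k = (\<lambda>y. theta R t k + ereal (slope R t k \<bullet> (y - trial R (t - 1) k))) \<and>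
           sel R t k =
             (\<Union>i\<in>{1..k}. selected strategy (sel R t (k - 1)) k (\<lambda>l. cut R t l (trial R (t - 1) i))) \<and>
           approx R t k = (\<lambda>y. MAX l\<in>sel R t k. cut R t l y)))"


section \<open>Vertex solutions of the linear subproblems\<close>

text \<open>
  The subproblem with polyhedral \<open>\<phi>\<close> is the linear program of minimising
  \<open>stage_cost P t x y + z\<close> over the pairs \<open>(x, z)\<close> with \<open>x\<close> feasible and \<open>\<phi> x \<le> z\<close>,
  and a vertex means a vertex of that polyhedron. (The projections \<open>x\<close> need not be vertices
  of the feasible set.) If \<open>\<phi>\<close> is constantly \<open>-\<infinity>\<close>, the variable \<open>z\<close> is dropped.
\<close>

definition primal_vertex ::
  "('n::finite) lp_data \<Rightarrow> nat \<Rightarrow> (real ^ 'n \<Rightarrow> ereal) \<Rightarrow> real ^ 'n \<Rightarrow> real ^ 'n \<Rightarrow> bool" where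
  "primal_vertex P t \<phi> y x \<longleftrightarrow>
     (if \<phi> = (\<lambda>_. -\<infinity>) then x extreme_point_of stage_feasible P t y
      else (x, real_of_ereal (\<phi> x)) extreme_point_of
             {(u, z). u \<in> stage_feasible P t y \<and> \<phi> u \<le> ereal z})"

text \<open>
  The affine functions \<open>y \<mapsto> s \<bullet> y + r\<close>, coded as \<open>(s, r)\<close>, whose maximum is \<open>Q\<^sub>t\<^sup>k\<close>;
  selected cuts that are constantly \<open>-\<infinity>\<close> do not contribute.
\<close>

definition pieces :: "('n::finite) lp_data \<Rightarrow> 'n ddp_seq \<Rightarrow> nat \<Rightarrow> nat \<Rightarrow> ((real ^ 'n) \<times> real) set" where
  "pieces P R t k =
     (if t = stages P + 1 then {(0, 0)}
      else {(s, r). \<exists>l\<in>sel R t k. cut R t l = (\<lambda>y. ereal (s \<bullet> y + r))})"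

text \<open>
  Dual of the subproblem, where \<open>X\<^sub>t = {x. \<forall>(g, h)\<in>F. g \<bullet> x \<le> h}\<close> and \<open>\<phi>\<close> is the maximum
  of the affine functions in \<open>K\<close>. The multipliers are \<open>\<nu>\<close> (free) for
  \<open>A\<^sub>t x + B\<^sub>t y = b\<^sub>t\<close>, \<open>\<mu> \<ge> 0\<close> for \<open>F\<close> and \<open>\<rho> \<ge> 0\<close> for the constraints
  \<open>s \<bullet> x + r \<le> z\<close>; they vanish outside their index sets.
\<close>

definition dual_equations ::
  "('n::finite) lp_data \<Rightarrow> nat \<Rightarrow> ((real ^ 'n) \<times> real) set \<Rightarrow> ((real ^ 'n) \<times> real) set
    \<Rightarrow> (nat \<Rightarrow> real) \<Rightarrow> ((real ^ 'n) \<times> real \<Rightarrow> real) \<Rightarrow> ((real ^ 'n) \<times> real \<Rightarrow> real) \<Rightarrow> bool" where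
  "dual_equations P t F K \<nu> \<mu> \<rho> \<longleftrightarrow>
     (\<forall>i. i \<ge> nrows P t \<longrightarrow> \<nu> i = 0) \<and> (\<forall>p. p \<notin> F \<longrightarrow> \<mu> p = 0) \<and> (\<forall>q. q \<notin> K \<longrightarrow> \<rho> q = 0) \<and>
     c_vec P t + (\<Sum>i<nrows P t. \<nu> i *\<^sub>R A_row P t i)
       + (\<Sum>p\<in>F. \<mu> p *\<^sub>R fst p) + (\<Sum>q\<in>K. \<rho> q *\<^sub>R fst q) = 0 \<and>
     (\<Sum>q\<in>K. \<rho> q) = 1"

definition dual_feasible ::
  "('n::finite) lp_data \<Rightarrow> nat \<Rightarrow> ((real ^ 'n) \<times> real) set \<Rightarrow> ((real ^ 'n) \<times> real) set
    \<Rightarrow> (nat \<Rightarrow> real) \<Rightarrow> ((real ^ 'n) \<times> real \<Rightarrow> real) \<Rightarrow> ((real ^ 'n) \<times> real \<Rightarrow> real) \<Rightarrow> bool" where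
  "dual_feasible P t F K \<nu> \<mu> \<rho> \<longleftrightarrow>
     dual_equations P t F K \<nu> \<mu> \<rho> \<and> (\<forall>p. \<mu> p \<ge> 0) \<and> (\<forall>q. \<rho> q \<ge> 0)"

definition dual_objective ::
  "('n::finite) lp_data \<Rightarrow> nat \<Rightarrow> ((real ^ 'n) \<times> real) set \<Rightarrow> ((real ^ 'n) \<times> real) set \<Rightarrow> real ^ 'n
    \<Rightarrow> (nat \<Rightarrow> real) \<Rightarrow> ((real ^ 'n) \<times> real \<Rightarrow> real) \<Rightarrow> ((real ^ 'n) \<times> real \<Rightarrow> real) \<Rightarrow> real" where
  "dual_objective P t F K y \<nu> \<mu> \<rho> =
     d_vec P t \<bullet> y + (\<Sum>i<nrows P t. \<nu> i * (B_row P t i \<bullet> y - b_rhs P t i))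
       - (\<Sum>p\<in>F. \<mu> p * snd p) + (\<Sum>q\<in>K. \<rho> q * snd q)"

definition dual_optimal ::
  "('n::finite) lp_data \<Rightarrow> nat \<Rightarrow> ((real ^ 'n) \<times> real) set \<Rightarrow> ((real ^ 'n) \<times> real) set \<Rightarrow> real ^ 'n
    \<Rightarrow> (nat \<Rightarrow> real) \<Rightarrow> ((real ^ 'n) \<times> real \<Rightarrow> real) \<Rightarrow> ((real ^ 'n) \<times> real \<Rightarrow> real) \<Rightarrow> bool" where
  "dual_optimal P t F K y \<nu> \<mu> \<rho> \<longleftrightarrow>
     dual_feasible P t F K \<nu> \<mu> \<rho> \<and>
     (\<forall>\<nu>2 \<mu>2 \<rho>2. dual_feasible P t F K \<nu>2 \<mu>2 \<rho>2 \<longrightarrow>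
        dual_objective P t F K y \<nu>2 \<mu>2 \<rho>2 \<le> dual_objective P t F K y \<nu> \<mu> \<rho>)"

text \<open>
  Basic solutions: the nonzero multipliers are determined by the dual equations, i.e. the columns
  they multiply are linearly independent. Basic feasible solutions are the vertices of the dual
  in standard form (\<open>\<nu>\<close> split into its positive and negative parts). If the dual written
  with a free \<open>\<nu>\<close> has vertices, they are among them; unlike those, basic solutions also
  exist when \<open>A\<^sub>t\<close> has linearly dependent rows.
\<close>

definition dual_basic ::
  "('n::finite) lp_data \<Rightarrow> nat \<Rightarrow> ((real ^ 'n) \<times> real) set \<Rightarrow> ((real ^ 'n) \<times> real) set
    \<Rightarrow> (nat \<Rightarrow> real) \<Rightarrow> ((real ^ 'n) \<times> real \<Rightarrow> real) \<Rightarrow> ((real ^ 'n) \<times> real \<Rightarrow> real) \<Rightarrow> bool" where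
  "dual_basic P t F K \<nu> \<mu> \<rho> \<longleftrightarrow>
     dual_equations P t F K \<nu> \<mu> \<rho> \<and>
     (\<forall>\<nu>2 \<mu>2 \<rho>2. dual_equations P t F K \<nu>2 \<mu>2 \<rho>2 \<and>
        (\<forall>i. \<nu> i = 0 \<longrightarrow> \<nu>2 i = 0) \<and> (\<forall>p. \<mu> p = 0 \<longrightarrow> \<mu>2 p = 0) \<and> (\<forall>q. \<rho> q = 0 \<longrightarrow> \<rho>2 q = 0)
        \<longrightarrow> \<nu>2 = \<nu> \<and> \<mu>2 = \<mu> \<and> \<rho>2 = \<rho>)"

text \<open>
  The subgradient read off from an optimal dual vertex: differentiate the dual objective
  with respect to \<open>y\<close>.
\<close>

definition dual_vertex_subgradient ::
  "('n::finite) lp_data \<Rightarrow> nat \<Rightarrow> ((real ^ 'n) \<times> real) set \<Rightarrow> ((real ^ 'n) \<times> real) set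
    \<Rightarrow> real ^ 'n \<Rightarrow> real ^ 'n \<Rightarrow> bool" where
  "dual_vertex_subgradient P t F K y s \<longleftrightarrow>
     (\<exists>\<nu> \<mu> \<rho>. dual_optimal P t F K y \<nu> \<mu> \<rho> \<and> dual_basic P t F K \<nu> \<mu> \<rho> \<and>
        s = d_vec P t + (\<Sum>i<nrows P t. \<nu> i *\<^sub>R B_row P t i))"

text \<open>
  Every linear subproblem is solved by an algorithm that outputs vertices, for the primal (the trial
  points) and for the dual (the subgradients), as the simplex algorithm does. \<open>F t\<close> is the
  description of \<open>X\<^sub>t\<close> by linear inequalities passed to the solver; it is the same at all
  iterations. For a cost-to-go \<open>-\<infinity>\<close> there is no cut, hence no dual condition.

  The dual part cannot be dropped. At a kink of the value function there are infinitely many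
  subgradients; if they are chosen arbitrarily, the same trial point can be visited forever
  and yield a new cut each time, all of which are kept by Level 1 and by the Territory algorithm.
\<close>

definition vertex_solutions ::
  "('n::finite) lp_data \<Rightarrow> (nat \<Rightarrow> ((real ^ 'n) \<times> real) set) \<Rightarrow> 'n ddp_seq \<Rightarrow> bool" where
  "vertex_solutions P F R \<longleftrightarrow>
     (\<forall>k\<ge>1. \<forall>t\<in>{1..stages P}.
        primal_vertex P t (approx R (t + 1) (k - 1)) (trial R (t - 1) k) (trial R t k)) \<and>
     (\<forall>k\<ge>1. \<forall>t\<in>{2..stages P}. approx R (t + 1) (k - 1) \<noteq> (\<lambda>_. -\<infinity>) \<longrightarrow>
        dual_vertex_subgradient P t (F t) (pieces P R (t + 1) (k - 1))
          (trial R (t - 1) k) (slope R t k))"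

end

theory Submission
  imports Defs
begin

text \<open>
  A basic dual solution is determined by its support, so finitely many cost-to-go functions at
  stage \<open>t + 1\<close> yield finitely many slopes at stage \<open>t\<close>. The intercept of a cut is the value at
  the slope of a conjugate of the stage value function, hence is determined by the slope and the
  next cost-to-go function, without reference to the trial point. By backward induction on the
  stage there are finitely many distinct cuts, and by forward induction finitely many trial points,
  these being extreme points of finitely many polyhedra.

  At a trial point already visited, the approximations are nondecreasing in the iteration. As they
  take finitely many values, they are eventually constant there; from then on a selected cut stays
  selected, and finiteness of the set of cuts makes the approximations themselves constant. They
  always lie below the optimal cost-to-go, and once \<open>Q\<^sub>t\<^sup>k = Q\<^sub>t\<^sup>k\<^sup>-\<^sup>1\<close> for all \<open>t\<close>, the new cut shows
  that along the trial trajectory they also lie above its remaining cost, which is thus optimal.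
\<close>

section \<open>Polyhedra and eventually constant sequences\<close>

text \<open>Among the finitely many values taken from \<open>N\<close> on there is a maximal one;
  once it is reached, monotonicity forbids leaving it. The order may be partial: the lemma serves
  for functions ordered pointwise and for sets ordered by inclusion.\<close>

lemma eventually_constant_of_finite_range:
  fixes f :: "nat \<Rightarrow> 'a::order"
  assumes mono: "\<And>k. k \<ge> N \<Longrightarrow> f k \<le> f (Suc k)" and fin: "finite (range f)"
  shows "\<exists>M\<ge>N. \<forall>k\<ge>M. f k = f M"
proof -
  have "finite (f ` {N..})" "f ` {N..} \<noteq> {}"
    using finite_subset[OF image_mono[OF subset_UNIV] fin] by auto
  then obtain m where m: "m \<in> f ` {N..}" "\<And>b. b \<in> f ` {N..} \<Longrightarrow> m \<le> b \<Longrightarrow> m = b"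
    using finite_has_maximal by metis
  then obtain M where M: "M \<ge> N" "m = f M" by auto
  have "f M \<le> f k" if "k \<ge> M" for k
    using that
  proof (induction k rule: dec_induct)
    case (step n)
    then show ?case using mono[of n] M(1) by force
  qed simp
  then show ?thesis using M m(2) by (metis atLeast_iff imageI le_trans)
qed

lemma polyhedron_Times_UNIV:
  fixes S :: "'a::euclidean_space set"
  assumes "polyhedron S"
  shows "polyhedron (S \<times> (UNIV :: 'b::euclidean_space set))"
proof -
  obtain H where H: "finite H" "S = \<Inter>H" "\<And>h. h \<in> H \<Longrightarrow> \<exists>a b. a \<noteq> 0 \<and> h = {x. a \<bullet> x \<le> b}"
    using assms unfolding polyhedron_def by metis
  have "polyhedron (h \<times> (UNIV :: 'b set))" if h: "h \<in> H" for h
  proof -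
    obtain a b where "h = {x. a \<bullet> x \<le> b}" using H(3)[OF h] by blast
    then have "h \<times> (UNIV :: 'b set) = {p. (a, 0) \<bullet> p \<le> b}" by auto
    then show ?thesis by (simp add: polyhedron_halfspace_le)
  qed
  moreover have "S \<times> (UNIV :: 'b set) = (\<Inter>h\<in>H. h \<times> UNIV)"
    using H(2) by auto
  ultimately show ?thesis using H(1) by auto
qed

section \<open>Cuts\<close>

text \<open>The value \<open>a\<close> at the base point is an extended real, so that the cuts that
  are constantly \<open>-\<infinity>\<close> are covered.\<close>

definition affine_cut :: "(real ^ 'n::finite \<Rightarrow> ereal) \<Rightarrow> bool" where
  "affine_cut c \<longleftrightarrow> (\<exists>a s y. c = (\<lambda>z. a + ereal (s \<bullet> (z - y))))"

text \<open>Indexed by the cut functions themselves and not by iterations: many iterations may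
  produce the same function, and it is the functions that are finite in number.\<close>

definition max_of_cuts :: "(real ^ 'n::finite \<Rightarrow> ereal) set \<Rightarrow> real ^ 'n \<Rightarrow> ereal" where
  "max_of_cuts C = (\<lambda>y. MAX c\<in>C. c y)"

definition affine_pieces :: "(real ^ 'n::finite \<Rightarrow> ereal) set \<Rightarrow> ((real ^ 'n) \<times> real) set" where
  "affine_pieces C = {(s, r). (\<lambda>y. ereal (s \<bullet> y + r)) \<in> C}"

lemma affine_cut_const: "affine_cut (\<lambda>_. a)"
  unfolding affine_cut_def by (rule exI[of _ a], rule exI[of _ 0]) simp

lemma affine_function_inject:
  fixes s s' :: "real ^ 'n::finite"
  assumes "(\<lambda>y. ereal (s \<bullet> y + r)) = (\<lambda>y. ereal (s' \<bullet> y + r'))"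
  shows "s = s'" "r = r'"
proof -
  have eq: "s \<bullet> y + r = s' \<bullet> y + r'" for y
    using fun_cong[OF assms, of y] by simp
  show "r = r'" using eq[of 0] by simp
  then show "s = s'" using eq by (metis add_right_cancel vector_eq_rdot inner_commute)
qed

lemma finite_affine_pieces:
  assumes "finite C"
  shows "finite (affine_pieces C)"
proof -
  have "inj (\<lambda>(s :: real ^ 'a, r). (\<lambda>y. ereal (s \<bullet> y + r)))"
    by (auto intro!: injI dest: affine_function_inject)
  then have "finite ((\<lambda>(s :: real ^ 'a, r). (\<lambda>y. ereal (s \<bullet> y + r))) -` C)"
    by (rule finite_vimageI[OF assms])
  moreover have "affine_pieces C = (\<lambda>(s :: real ^ 'a, r). (\<lambda>y. ereal (s \<bullet> y + r))) -` C"
    by (auto simp: affine_pieces_def)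
  ultimately show ?thesis by simp
qed

lemma polyhedron_cut_epigraph:
  fixes c :: "real ^ 'n::finite \<Rightarrow> ereal"
  assumes "affine_cut c"
  shows "polyhedron {(u, z). c u \<le> ereal z}"
proof -
  obtain a s y where c: "c = (\<lambda>z. a + ereal (s \<bullet> (z - y)))"
    using assms affine_cut_def by metis
  show ?thesis
  proof (cases a)
    case (real r)
    then have "{(u, z). c u \<le> ereal z} = {p. (s, - 1) \<bullet> p \<le> s \<bullet> y - r}"
      by (auto simp: c inner_diff_right)
    then show ?thesis by (simp add: polyhedron_halfspace_le)
  next
    case PInf
    then have "{(u, z). c u \<le> ereal z} = {}" by (auto simp: c)
    then show ?thesis by simp
  next
    case MInf
    then have "{(u, z). c u \<le> ereal z} = UNIV" by (auto simp: c)
    then show ?thesis by simp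
  qed
qed

lemma polyhedron_max_epigraph:
  fixes C :: "(real ^ 'n::finite \<Rightarrow> ereal) set"
  assumes "finite C" "C \<noteq> {}" "\<And>c. c \<in> C \<Longrightarrow> affine_cut c"
  shows "polyhedron {(u, z). max_of_cuts C u \<le> ereal z}"
proof -
  have "{(u, z). max_of_cuts C u \<le> ereal z} = (\<Inter>c\<in>C. {(u, z). c u \<le> ereal z})"
    using assms(1,2) by (auto simp: max_of_cuts_def)
  moreover have "polyhedron (\<Inter>c\<in>C. {(u, z). c u \<le> ereal z})"
    using assms polyhedron_cut_epigraph by (intro polyhedron_Inter) auto
  ultimately show ?thesis by simp
qed

text \<open>The subgradient inequality says that \<open>x\<close> minimises
  \<open>V z - s \<bullet> z\<close>. The cut is thus \<open>s \<bullet> y\<close> minus the convex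
  conjugate of \<open>V\<close> at \<open>s\<close>, and the base point \<open>x\<close> disappears
  from the formula.\<close>

lemma subgradient_cut_eq_INF:
  assumes "is_subgradient V x s"
  shows "V x + ereal (s \<bullet> (y - x)) = (INF z. V z + ereal (s \<bullet> (y - z)))"
proof (rule antisym)
  show "V x + ereal (s \<bullet> (y - x)) \<le> (INF z. V z + ereal (s \<bullet> (y - z)))"
  proof (rule INF_greatest)
    fix z
    have "V x + ereal (s \<bullet> (y - x)) = V x + ereal (s \<bullet> (z - x)) + ereal (s \<bullet> (y - z))"
      by (simp add: add.assoc inner_diff_right)
    also have "\<dots> \<le> V z + ereal (s \<bullet> (y - z))"
      using assms unfolding is_subgradient_def by (intro add_right_mono) blast
    finally show "V x + ereal (s \<bullet> (y - x)) \<le> V z + ereal (s \<bullet> (y - z))" .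
  qed
qed (rule INF_lower, simp)

section \<open>Vertices of the subproblems\<close>

lemma polyhedron_stage_feasible:
  assumes "polyhedron (X_set P t)"
  shows "polyhedron (stage_feasible P t y)"
proof -
  have "stage_feasible P t y =
      X_set P t \<inter> (\<Inter>i\<in>{..<nrows P t}. {x. A_row P t i \<bullet> x = b_rhs P t i - B_row P t i \<bullet> y})"
    by (auto simp: stage_feasible_def algebra_simps)
  moreover have "polyhedron (\<Inter>i\<in>{..<nrows P t}. {x. A_row P t i \<bullet> x = b_rhs P t i - B_row P t i \<bullet> y})"
    by (rule polyhedron_Inter) (auto simp: polyhedron_hyperplane)
  ultimately show ?thesis using assms by simp
qed

text \<open>In the pairs \<open>(u, z)\<close>, the subproblem lives on a cylinder over the feasible
  set cut by an epigraph. This is a polyhedron, with finitely many extreme points, and the trial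
  points are their first components. The other set in the union covers the case of a cost-to-go
  \<open>-\<infinity>\<close>.\<close>

lemma finite_primal_vertices:
  assumes "polyhedron (X_set P t)" "finite C" "C \<noteq> {}" "\<And>c. c \<in> C \<Longrightarrow> affine_cut c"
  shows "finite {x. primal_vertex P t (max_of_cuts C) y x}"
proof -
  let ?E = "{(u, z). u \<in> stage_feasible P t y \<and> max_of_cuts C u \<le> ereal z}"
  have feas: "polyhedron (stage_feasible P t y)"
    using assms(1) by (rule polyhedron_stage_feasible)
  have "?E = stage_feasible P t y \<times> UNIV \<inter> {(u, z). max_of_cuts C u \<le> ereal z}" by auto
  then have "polyhedron ?E"
    using polyhedron_Times_UNIV[OF feas, where 'b = real] polyhedron_max_epigraph[OF assms(2-4)]
    by simp
  then have "finite (fst ` {p. p extreme_point_of ?E})"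
    by (intro finite_imageI finite_polyhedron_extreme_points)
  moreover have "finite {x. x extreme_point_of stage_feasible P t y}"
    using feas by (rule finite_polyhedron_extreme_points)
  moreover have "{x. primal_vertex P t (max_of_cuts C) y x} \<subseteq>
      {x. x extreme_point_of stage_feasible P t y} \<union> fst ` {p. p extreme_point_of ?E}"
    by (force simp: primal_vertex_def split: if_splits)
  ultimately show ?thesis by (meson finite_UnI finite_subset)
qed

text \<open>A basic solution is the only solution of the dual equations that vanishes wherever it
  does. Hence its supports determine it, and they are subsets of finite index sets.\<close>

lemma finite_dual_basic:
  assumes "finite F" "finite K"
  shows "finite {(\<nu>, \<mu>, \<rho>). dual_basic P t F K \<nu> \<mu> \<rho>}"
proof -
  let ?D = "{(\<nu>, \<mu>, \<rho>). dual_basic P t F K \<nu> \<mu> \<rho>}"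
  let ?supp = "\<lambda>(\<nu> :: nat \<Rightarrow> real, \<mu> :: (real ^ 'a) \<times> real \<Rightarrow> real, \<rho> :: (real ^ 'a) \<times> real \<Rightarrow> real).
    ({i. \<nu> i \<noteq> 0}, {p. \<mu> p \<noteq> 0}, {q. \<rho> q \<noteq> 0})"
  have "inj_on ?supp ?D"
  proof (rule inj_onI)
    fix p q assume "p \<in> ?D" "q \<in> ?D" and supp: "?supp p = ?supp q"
    then obtain \<nu> \<mu> \<rho> \<nu>2 \<mu>2 \<rho>2
      where p: "p = (\<nu>, \<mu>, \<rho>)" "dual_basic P t F K \<nu> \<mu> \<rho>"
        and q: "q = (\<nu>2, \<mu>2, \<rho>2)" "dual_basic P t F K \<nu>2 \<mu>2 \<rho>2"
      by auto
    have "\<nu> i = 0 \<longleftrightarrow> \<nu>2 i = 0" "\<mu> x = 0 \<longleftrightarrow> \<mu>2 x = 0" "\<rho> x = 0 \<longleftrightarrow> \<rho>2 x = 0" for i x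
      using supp unfolding p(1) q(1) by (simp_all add: set_eq_iff) (metis surj_pair)+
    then show "p = q"
      using p q unfolding dual_basic_def by blast
  qed
  moreover have "?supp ` ?D \<subseteq> Pow {..<nrows P t} \<times> Pow F \<times> Pow K"
    by (auto simp: dual_basic_def dual_equations_def) (metis not_le)
  ultimately show ?thesis
    using assms by (meson finite_Pow_iff finite_SigmaI finite_lessThan inj_on_finite)
qed

text \<open>The point \<open>y\<close> enters only the dual objective, which decides which basic
  solution is chosen; the basic solutions themselves are the same for all \<open>y\<close>, so one
  finite set serves all trial points.\<close>

lemma finite_dual_vertex_subgradients:
  assumes "finite F" "finite K"
  shows "finite {s. \<exists>y. dual_vertex_subgradient P t F K y s}"
proof -
  have "{s. \<exists>y. dual_vertex_subgradient P t F K y s} \<subseteq>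
      (\<lambda>(\<nu>, \<mu>, \<rho>). d_vec P t + (\<Sum>i<nrows P t. \<nu> i *\<^sub>R B_row P t i)) `
        {(\<nu>, \<mu>, \<rho>). dual_basic P t F K \<nu> \<mu> \<rho>}"
    by (force simp: dual_vertex_subgradient_def)
  then show ?thesis
    using finite_dual_basic[OF assms] finite_surj by blast
qed

section \<open>Cut selection\<close>

text \<open>The cuts among which maximizers are sought. It lets the three strategies be treated
  together, except where the tie-breaking of limited memory matters.\<close>

definition candidates :: "selection_strategy \<Rightarrow> nat set \<Rightarrow> nat \<Rightarrow> nat set" where
  "candidates strategy S k = (if strategy = Territory then S \<union> {k} else {1..k})"

lemma finite_arg_max_nonempty:
  fixes v :: "nat \<Rightarrow> 'a::linorder"
  assumes "finite D" "D \<noteq> {}"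
  shows "\<exists>l. is_arg_max v (\<lambda>l. l \<in> D) l"
proof -
  have "Max (v ` D) \<in> v ` D" using assms by (intro Max_in) auto
  then obtain l where "l \<in> D" "v l = Max (v ` D)" by (metis imageE)
  then show ?thesis using assms(1) by (auto simp: is_arg_max_linorder)
qed

lemma finite_candidates: "finite S \<Longrightarrow> finite (candidates strategy S k)"
  by (simp add: candidates_def)

lemma self_candidate: "1 \<le> k \<Longrightarrow> k \<in> candidates strategy S k"
  by (simp add: candidates_def)

lemma selected_arg_max:
  assumes "1 \<le> k" "l \<in> selected strategy S k v"
  shows "is_arg_max v (\<lambda>l. l \<in> candidates strategy S k) l"
proof (cases strategy)
  case LimitedMemoryLevel1
  let ?M = "{l. is_arg_max v (\<lambda>l. l \<in> {1..k}) l}"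
  have "finite ?M" by (rule finite_subset[of _ "{1..k}"]) (auto simp: is_arg_max_def)
  moreover have "?M \<noteq> {}" using finite_arg_max_nonempty[of "{1..k}" v] assms(1) by auto
  ultimately have "Min ?M \<in> ?M" by (rule Min_in)
  then show ?thesis using assms LimitedMemoryLevel1 by (simp add: candidates_def)
qed (use assms in \<open>auto simp: candidates_def\<close>)

lemma selected_nonempty:
  assumes "1 \<le> k" "finite S"
  shows "selected strategy S k v \<noteq> {}"
proof (cases strategy)
  case Level1
  then show ?thesis using finite_arg_max_nonempty[of "{1..k}" v] assms(1) by auto
next
  case Territory
  then show ?thesis using finite_arg_max_nonempty[of "S \<union> {k}" v] assms(2) by auto
qed simp

text \<open>A maximizer that no new candidate exceeds is still a maximizer. The Territory algorithm
  also requires that it has not been discarded, whence \<open>l \<in> S'\<close>.\<close>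

lemma selected_persists:
  assumes k: "1 \<le> k" and l: "l \<in> selected strategy S k v" "l \<in> S'"
    and max: "\<And>m. m \<in> candidates strategy S' (Suc k) \<Longrightarrow> v m \<le> v l"
  shows "l \<in> selected strategy S' (Suc k) v"
proof -
  have am: "is_arg_max v (\<lambda>l. l \<in> candidates strategy S k) l"
    using selected_arg_max[OF k l(1)] .
  show ?thesis
  proof (cases strategy)
    case Level1
    then show ?thesis using am max by (auto simp: is_arg_max_linorder candidates_def)
  next
    case Territory
    then show ?thesis using l(2) max by (auto simp: is_arg_max_linorder candidates_def)
  next
    case LimitedMemoryLevel1
    let ?M = "\<lambda>k. {l. is_arg_max v (\<lambda>l. l \<in> {1..k}) l}"
    have in_M: "l \<in> ?M (Suc k)" and lk: "l \<in> {1..k}"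
      using am max LimitedMemoryLevel1 by (auto simp: is_arg_max_linorder candidates_def)
    have fin: "finite (?M j)" for j
      by (rule finite_subset[of _ "{1..j}"]) (auto simp: is_arg_max_def)
    have lmin: "l = Min (?M k)" using l(1) LimitedMemoryLevel1 by simp
    \<comment> \<open>Ties do not dislodge \<open>l\<close>: the new cut has a larger index, and any
      other maximizer was already one at step \<open>k\<close>, when \<open>l\<close> was the
      oldest.\<close>
    have "l \<le> m" if m: "m \<in> ?M (Suc k)" for m
    proof (cases "m = Suc k")
      case True
      then show ?thesis using lk by simp
    next
      case False
      then have "m \<in> ?M k" using m by (auto simp: is_arg_max_linorder)
      then show ?thesis using lmin fin by simp
    qed
    then have "Min (?M (Suc k)) = l" using in_M fin by (intro Min_eqI) auto
    then show ?thesis using LimitedMemoryLevel1 by simp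
  qed
qed

section \<open>Runs of the algorithm\<close>

text \<open>The zero cost-to-go after the last stage is counted as a single cut, which makes stage
  \<open>T + 1\<close> the base case of the backward inductions.\<close>

definition cut_functions :: "'n::finite lp_data \<Rightarrow> 'n ddp_seq \<Rightarrow> nat \<Rightarrow> nat \<Rightarrow> (real ^ 'n \<Rightarrow> ereal) set" where
  "cut_functions P R t k = (if t = stages P + 1 then {\<lambda>_. 0} else cut R t ` sel R t k)"

text \<open>Hence the dual subproblem depends on the iteration only through the set of cut
  functions.\<close>

lemma pieces_eq: "pieces P R t k = affine_pieces (cut_functions P R t k)"
proof -
  have "(\<lambda>y. ereal (s \<bullet> y + r)) = (\<lambda>_. 0) \<longleftrightarrow> s = 0 \<and> r = 0" for s :: "real ^ 'a" and r
    using affine_function_inject[of s r 0 0] by (auto simp: zero_ereal_def)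
  then show ?thesis
    by (simp add: pieces_def affine_pieces_def cut_functions_def image_iff Bex_def eq_commute
        set_eq_iff)
qed

section \<open>Index sets and cut functions along a run\<close>

locale ddp =
  fixes P :: "('n::finite) lp_data" and strategy :: selection_strategy and R :: "'n ddp_seq"
  assumes run: "ddp_run P strategy R"
begin

lemma approx_last: "approx R (Suc (stages P)) k = (\<lambda>_. 0)"
  using run by (simp add: ddp_run_def)

lemma iteration_0:
  assumes "t \<in> {2..stages P}"
  shows "sel R t 0 = {0}" "cut R t 0 = (\<lambda>_. -\<infinity>)" "approx R t 0 = (\<lambda>_. -\<infinity>)"
  using run assms by (simp_all add: ddp_run_def)

lemma trial_0: "1 \<le> k \<Longrightarrow> trial R 0 k = x_init P"
  using run by (simp add: ddp_run_def)

lemma trial_optimal: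
  assumes "1 \<le> k" "t \<in> {1..stages P}"
  shows "stage_optimal P t (approx R (Suc t) (k - 1)) (trial R (t - 1) k) (trial R t k)"
  using run assms by (simp add: ddp_run_def)

lemma iteration:
  assumes "1 \<le> k" "t \<in> {2..stages P}"
  shows theta_eq: "theta R t k = stage_value P t (approx R (Suc t) (k - 1)) (trial R (t - 1) k)"
    and slope_subgradient: "is_subgradient (stage_value P t (approx R (Suc t) (k - 1)))
             (trial R (t - 1) k) (slope R t k)"
    and cut_eq: "cut R t k = (\<lambda>y. theta R t k + ereal (slope R t k \<bullet> (y - trial R (t - 1) k)))"
    and sel_eq: "sel R t k =
             (\<Union>i\<in>{1..k}. selected strategy (sel R t (k - 1)) k (\<lambda>l. cut R t l (trial R (t - 1) i)))"
    and approx_eq: "approx R t k = (\<lambda>y. MAX l\<in>sel R t k. cut R t l y)"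
  using run assms by (simp_all add: ddp_run_def)

lemma sel_subset_candidates:
  assumes "1 \<le> k" "t \<in> {2..stages P}"
  shows "sel R t k \<subseteq> candidates strategy (sel R t (k - 1)) k"
  using sel_eq[OF assms] selected_arg_max[OF assms(1)] by (fastforce simp: is_arg_max_def)

lemma finite_sel: "t \<in> {2..stages P} \<Longrightarrow> finite (sel R t k)"
proof (induction k)
  case (Suc k)
  then show ?case
    using sel_subset_candidates[of "Suc k" t] finite_candidates finite_subset by fastforce
qed (simp add: iteration_0)

lemma sel_nonempty:
  assumes "t \<in> {2..stages P}"
  shows "sel R t k \<noteq> {}"
proof (cases "k = 0")
  case False
  then have k: "1 \<le> k" by simp
  show ?thesis
    using sel_eq[OF k assms] selected_nonempty[OF k finite_sel[OF assms]] k by fastforce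
qed (simp add: iteration_0(1)[OF assms])

lemma approx_eq_max:
  assumes "t \<in> {2..Suc (stages P)}"
  shows "approx R t k = max_of_cuts (cut_functions P R t k)"
proof (cases "t = Suc (stages P)")
  case True
  then show ?thesis by (simp add: approx_last max_of_cuts_def cut_functions_def)
next
  case False
  then have t: "t \<in> {2..stages P}" using assms by auto
  show ?thesis
  proof (cases "k = 0")
    case True
    then show ?thesis
      using False t by (simp add: iteration_0 max_of_cuts_def cut_functions_def)
  next
    case k: False
    then show ?thesis
      using False approx_eq[of k t] t by (simp add: max_of_cuts_def cut_functions_def image_image)
  qed
qed

lemma cut_functions_affine:
  assumes "t \<in> {2..Suc (stages P)}" "c \<in> cut_functions P R t k"
  shows "affine_cut c"
proof (cases "t = Suc (stages P)")
  case True
  then show ?thesis using assms by (simp add: cut_functions_def affine_cut_const)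
next
  case False
  then obtain l where l: "c = cut R t l" and t: "t \<in> {2..stages P}"
    using assms by (auto simp: cut_functions_def)
  show ?thesis
  proof (cases "l = 0")
    case True
    then show ?thesis using l t by (simp add: iteration_0 affine_cut_const)
  next
    case False
    then show ?thesis using l t cut_eq[of l t] unfolding affine_cut_def by auto
  qed
qed

lemma cut_functions_finite_nonempty:
  assumes "t \<in> {2..Suc (stages P)}"
  shows "finite (cut_functions P R t k)" "cut_functions P R t k \<noteq> {}"
  using assms finite_sel[of t k] sel_nonempty[of t k] by (auto simp: cut_functions_def)

section \<open>Approximations at visited trial points\<close>

text \<open>Selection keeps a maximizer at each trial point visited so far, so discarding the other
  candidates does not lower the maximum there.\<close>

lemma candidate_le_approx:
  assumes k: "1 \<le> k" and t: "t \<in> {2..stages P}" and i: "i \<in> {1..k}"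
    and m: "m \<in> candidates strategy (sel R t (k - 1)) k"
  shows "cut R t m (trial R (t - 1) i) \<le> approx R t k (trial R (t - 1) i)"
proof -
  let ?v = "\<lambda>l. cut R t l (trial R (t - 1) i)"
  obtain l where l: "l \<in> selected strategy (sel R t (k - 1)) k ?v"
    using selected_nonempty[OF k finite_sel[OF t]] by blast
  then have "?v m \<le> ?v l"
    using selected_arg_max[OF k l] m by (simp add: is_arg_max_linorder)
  also have "?v l \<le> approx R t k (trial R (t - 1) i)"
  proof -
    have "l \<in> sel R t k"
      unfolding sel_eq[OF k t] using l i by blast
    then show ?thesis
      unfolding approx_eq[OF k t] using finite_sel[OF t] by (intro Max_ge) auto
  qed
  finally show ?thesis .
qed

text \<open>Every cut in \<open>sel R t k\<close> was itself a candidate, so none exceeds a cut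
  selected at this trial point.\<close>

lemma sel_attains_approx:
  assumes k: "1 \<le> k" and t: "t \<in> {2..stages P}"
    and l: "l \<in> selected strategy (sel R t (k - 1)) k (\<lambda>l. cut R t l (trial R (t - 1) i))"
  shows "approx R t k (trial R (t - 1) i) \<le> cut R t l (trial R (t - 1) i)"
  unfolding approx_eq[OF k t]
  using finite_sel[OF t] sel_nonempty[OF t] selected_arg_max[OF k l] sel_subset_candidates[OF k t]
  by (auto simp: is_arg_max_linorder)

lemma sel_subset_next_candidates:
  assumes "1 \<le> k" "t \<in> {2..stages P}"
  shows "sel R t k \<subseteq> candidates strategy (sel R t k) (Suc k)"
  using sel_subset_candidates[OF assms] by (fastforce simp: candidates_def)

text \<open>Discarding cuts may lower the approximation elsewhere, but at a visited trial point all
  cuts currently in use compete again in the next selection.\<close>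

lemma approx_mono:
  assumes k: "1 \<le> k" and t: "t \<in> {2..stages P}" and i: "i \<in> {1..k}"
  shows "approx R t k (trial R (t - 1) i) \<le> approx R t (Suc k) (trial R (t - 1) i)"
proof -
  have "cut R t l (trial R (t - 1) i) \<le> approx R t (Suc k) (trial R (t - 1) i)"
    if "l \<in> sel R t k" for l
    using candidate_le_approx[of "Suc k" t i l] that sel_subset_next_candidates[OF k t] t i by auto
  then show ?thesis
    unfolding approx_eq[OF k t] using finite_sel[OF t] sel_nonempty[OF t] by auto
qed

text \<open>A cut selected at trial point \<open>i\<close> attains the approximation there. If this
  value does not rise, no candidate of the next step exceeds the cut, and it is selected again at
  the same point.\<close>

lemma sel_mono:
  assumes k: "1 \<le> k" and t: "t \<in> {2..stages P}"
    and const: "\<And>i. i \<in> {1..k} \<Longrightarrow>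
      approx R t (Suc k) (trial R (t - 1) i) = approx R t k (trial R (t - 1) i)"
  shows "sel R t k \<subseteq> sel R t (Suc k)"
proof
  fix l assume lk: "l \<in> sel R t k"
  then obtain i where i: "i \<in> {1..k}"
    and l: "l \<in> selected strategy (sel R t (k - 1)) k (\<lambda>l. cut R t l (trial R (t - 1) i))"
    using sel_eq[OF k t] by auto
  have "cut R t m (trial R (t - 1) i) \<le> cut R t l (trial R (t - 1) i)"
    if "m \<in> candidates strategy (sel R t k) (Suc k)" for m
    using candidate_le_approx[of "Suc k" t i m] that t i const[OF i] sel_attains_approx[OF k t l]
    by auto
  then have "l \<in> selected strategy (sel R t k) (Suc k) (\<lambda>l. cut R t l (trial R (t - 1) i))"
    by (rule selected_persists[OF k l lk])
  moreover have "i \<in> {1..Suc k}" using i by simp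
  ultimately show "l \<in> sel R t (Suc k)"
    using sel_eq[of "Suc k" t] t by auto
qed

section \<open>Bounds on the cost-to-go and optimality\<close>

definition tail_cost :: "nat \<Rightarrow> (nat \<Rightarrow> real ^ 'n) \<Rightarrow> real" where
  "tail_cost t u = (\<Sum>s=t..stages P. stage_cost P s (u s) (u (s - 1)))"

lemma tail_cost_last: "tail_cost (Suc (stages P)) u = 0"
  by (simp add: tail_cost_def)

lemma tail_cost_step:
  "t \<le> stages P \<Longrightarrow> tail_cost t u = stage_cost P t (u t) (u (t - 1)) + tail_cost (Suc t) u"
  by (simp add: tail_cost_def sum.atLeast_Suc_atMost)

text \<open>By the subgradient inequality a cut lies below the stage value function that produced
  it, and this lies below the cost of any feasible continuation by backward induction. Cut
  \<open>l\<close> was built from the approximation of iteration \<open>l - 1\<close>, so the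
  induction needs all \<open>k\<close> at once.\<close>

lemma approx_le_tail_cost:
  assumes "t \<le> Suc (stages P)" "2 \<le> t"
    and "\<And>s. s \<in> {t..stages P} \<Longrightarrow> u s \<in> stage_feasible P s (u (s - 1))"
  shows "approx R t k (u (t - 1)) \<le> ereal (tail_cost t u)"
  using assms
proof (induction t arbitrary: k rule: inc_induct)
  case base
  then show ?case by (simp add: approx_last tail_cost_last)
next
  case (step t)
  then have t: "t \<in> {2..stages P}" by simp
  have cut_le: "cut R t l (u (t - 1)) \<le> ereal (tail_cost t u)" for l
  proof (cases "l = 0")
    case True
    then show ?thesis using iteration_0(2)[OF t] by simp
  next
    case False
    then have l: "1 \<le> l" by simp
    let ?V = "stage_value P t (approx R (Suc t) (l - 1))"
    have "cut R t l (u (t - 1)) \<le> ?V (u (t - 1))"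
      using slope_subgradient[OF l t] unfolding is_subgradient_def cut_eq[OF l t] theta_eq[OF l t]
      by blast
    also have "\<dots> \<le> ereal (stage_cost P t (u t) (u (t - 1))) + approx R (Suc t) (l - 1) (u t)"
      unfolding stage_value_def using step.prems t by (intro INF_lower) auto
    also have "\<dots> \<le> ereal (stage_cost P t (u t) (u (t - 1))) + ereal (tail_cost (Suc t) u)"
      using step.IH[of "l - 1"] step.prems by (intro add_left_mono) auto
    also have "\<dots> = ereal (tail_cost t u)" using t by (simp add: tail_cost_step)
    finally show ?thesis .
  qed
  have "approx R t k (u (t - 1)) = max_of_cuts (cut_functions P R t k) (u (t - 1))"
    using t by (subst approx_eq_max) auto
  then show ?case
    unfolding max_of_cuts_def
    using t cut_functions_finite_nonempty[of t k] cut_le by (auto simp: cut_functions_def)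
qed

text \<open>The new cut, at its own trial point, equals the stage cost plus the approximation used
  in the forward pass at the next trial point. Stability identifies the updated approximation with
  the one used in the forward pass, so the estimate can be chained backward over the stages.\<close>

lemma tail_cost_le_approx:
  assumes k: "1 \<le> k"
    and stable: "\<And>t. t \<in> {2..stages P} \<Longrightarrow> approx R t k = approx R t (k - 1)"
    and "t \<le> Suc (stages P)" "2 \<le> t"
  shows "ereal (tail_cost t (\<lambda>s. trial R s k)) \<le> approx R t (k - 1) (trial R (t - 1) k)"
  using assms(3,4)
proof (induction t rule: inc_induct)
  case base
  then show ?case by (simp add: approx_last tail_cost_last)
next
  case (step t)
  then have t: "t \<in> {2..stages P}" by simp
  let ?x = "\<lambda>s. trial R s k"
  have opt: "stage_optimal P t (approx R (Suc t) (k - 1)) (?x (t - 1)) (?x t)"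
    using trial_optimal[OF k, of t] t by simp
  have "ereal (tail_cost t ?x) =
      ereal (stage_cost P t (?x t) (?x (t - 1))) + ereal (tail_cost (Suc t) ?x)"
    using t by (simp add: tail_cost_step)
  also have "\<dots> \<le> ereal (stage_cost P t (?x t) (?x (t - 1))) + approx R (Suc t) (k - 1) (?x t)"
    using step.IH step.prems by (intro add_left_mono) simp
  \<comment> \<open>The linear term of the cut vanishes at its base point, leaving
    \<open>theta R t k\<close>, the value attained by the trial point.\<close>
  also have "\<dots> = cut R t k (?x (t - 1))"
    using opt theta_eq[OF k t] cut_eq[OF k t] by (simp add: stage_optimal_def)
  also have "\<dots> \<le> approx R t k (?x (t - 1))"
    using candidate_le_approx[OF k t, of k k] self_candidate[OF k] k by simp
  also have "\<dots> = approx R t (k - 1) (?x (t - 1))"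
    using stable[OF t] by simp
  finally show ?case .
qed

text \<open>The first-stage value with cost-to-go \<open>approx R 2 (k - 1)\<close> separates the
  costs: the trial policy costs at most this value, every feasible policy at least this
  value.\<close>

lemma trial_lp_optimal:
  assumes T: "1 \<le> stages P" and k: "1 \<le> k"
    and stable: "\<And>t. t \<in> {2..stages P} \<Longrightarrow> approx R t k = approx R t (k - 1)"
  shows "lp_optimal P (\<lambda>t. trial R t k)"
proof -
  let ?x = "\<lambda>t. trial R t k"
  \<comment> \<open>Stage 1 is split off since approximations start at stage 2. For a single stage
    the tail is empty.\<close>
  have cost: "lp_cost P u = stage_cost P 1 (u 1) (u 0) + tail_cost 2 u" for u
    using T tail_cost_step[of 1 u] by (simp add: lp_cost_def tail_cost_def numeral_2_eq_2)
  have feas: "lp_feasible P ?x"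
    using trial_0[OF k] trial_optimal[OF k] by (simp add: lp_feasible_def stage_optimal_def)
  have "lp_cost P ?x \<le> lp_cost P u" if u: "lp_feasible P u" for u
  proof -
    have u1: "u 1 \<in> stage_feasible P 1 (u 0)"
      using u T unfolding lp_feasible_def by (metis atLeastAtMost_iff diff_self_eq_0 order_refl)
    let ?V = "stage_value P 1 (approx R 2 (k - 1))"
    have "ereal (lp_cost P ?x) =
        ereal (stage_cost P 1 (?x 1) (?x 0)) + ereal (tail_cost 2 ?x)"
      by (simp add: cost)
    also have "\<dots> \<le> ereal (stage_cost P 1 (?x 1) (?x 0)) + approx R 2 (k - 1) (?x 1)"
      using tail_cost_le_approx[OF k stable, of 2] T by (intro add_left_mono) simp
    also have "\<dots> = ?V (?x 0)"
      using trial_optimal[OF k, of 1] T by (simp add: stage_optimal_def numeral_2_eq_2)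
    also have "\<dots> = ?V (u 0)"
      using feas u by (simp add: lp_feasible_def)
    also have "\<dots> \<le> ereal (stage_cost P 1 (u 1) (u 0)) + approx R 2 (k - 1) (u 1)"
      unfolding stage_value_def using u1 by (rule INF_lower)
    also have "\<dots> \<le> ereal (stage_cost P 1 (u 1) (u 0)) + ereal (tail_cost 2 u)"
      using approx_le_tail_cost[of 2 u "k - 1"] u T
      by (intro add_left_mono) (auto simp: lp_feasible_def)
    also have "\<dots> = ereal (lp_cost P u)" by (simp add: cost)
    finally show ?thesis by simp
  qed
  then show ?thesis
    using feas by (auto simp: lp_optimal_def is_arg_min_def not_less)
qed

end

section \<open>Finiteness of the cuts and of the trial points\<close>

locale ddp_vertex = ddp P strategy R
  for P :: "('n::finite) lp_data" and strategy and R :: "'n ddp_seq" +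
  fixes F :: "nat \<Rightarrow> ((real ^ 'n) \<times> real) set"
  assumes polyhedral: "\<And>t. t \<in> {1..stages P} \<Longrightarrow> polyhedron (X_set P t)"
    and finite_F: "\<And>t. t \<in> {1..stages P} \<Longrightarrow> finite (F t)"
    and vertices: "vertex_solutions P F R"
begin

text \<open>The trial point has been eliminated: a finite cut is a function of the set
  \<open>C\<close> of cuts of the next stage and of a slope from a set that depends only on
  \<open>C\<close> and the stage.\<close>

lemma cut_cases:
  assumes k: "1 \<le> k" and t: "t \<in> {2..stages P}"
  defines "C \<equiv> cut_functions P R (Suc t) (k - 1)"
  shows "cut R t k = (\<lambda>_. -\<infinity>) \<or>
    (\<exists>s\<in>{s. \<exists>y. dual_vertex_subgradient P t (F t) (affine_pieces C) y s}.
      cut R t k = (\<lambda>y. INF z. stage_value P t (max_of_cuts C) z + ereal (s \<bullet> (y - z))))"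
proof (cases "approx R (Suc t) (k - 1) = (\<lambda>_. -\<infinity>)")
  case True
  \<comment> \<open>The stage value is attained at the trial point, where the cost-to-go is
    \<open>-\<infinity>\<close>.\<close>
  have "theta R t k = -\<infinity>"
    using trial_optimal[OF k, of t] t unfolding theta_eq[OF k t] stage_optimal_def True by simp
  then show ?thesis using cut_eq[OF k t] by simp
next
  case False
  then have "dual_vertex_subgradient P t (F t) (affine_pieces C) (trial R (t - 1) k) (slope R t k)"
    using vertices k t unfolding vertex_solutions_def C_def pieces_eq[symmetric] by simp
  moreover have "cut R t k = (\<lambda>y. INF z. stage_value P t (max_of_cuts C) z + ereal (slope R t k \<bullet> (y - z)))"
    unfolding cut_eq[OF k t] theta_eq[OF k t] subgradient_cut_eq_INF[OF slope_subgradient[OF k t]]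
    using t by (subst approx_eq_max) (auto simp: C_def)
  ultimately show ?thesis by blast
qed

text \<open>Backward induction on the stage: finitely many cuts at stage \<open>t + 1\<close> have
  finitely many subsets \<open>C\<close>, each \<open>C\<close> admits finitely many slopes, and
  each pair of \<open>C\<close> and a slope gives one cut. The inserted constant accounts for cut 0
  and the other cuts of value \<open>-\<infinity>\<close>.\<close>

lemma finite_cut_functions:
  assumes "t \<le> Suc (stages P)" "2 \<le> t"
  shows "finite (\<Union>k. cut_functions P R t k)"
  using assms
proof (induction t rule: inc_induct)
  case base
  then show ?case by (simp add: cut_functions_def)
next
  case (step t)
  then have t: "t \<in> {2..stages P}" by simp
  let ?U = "\<Union>k. cut_functions P R (Suc t) k"
  let ?S = "\<lambda>C. {s. \<exists>y. dual_vertex_subgradient P t (F t) (affine_pieces C) y s}"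
  let ?c = "\<lambda>C s y. INF z. stage_value P t (max_of_cuts C) z + ereal (s \<bullet> (y - z))"
  have U: "finite ?U" using step.IH t by simp
  have "finite (?S C)" if "C \<in> Pow ?U" for C
    using that U finite_F[of t] t
    by (intro finite_dual_vertex_subgradients finite_affine_pieces) (auto intro: finite_subset)
  then have fin: "finite (insert (\<lambda>_. -\<infinity>) (\<Union>C\<in>Pow ?U. ?c C ` ?S C))"
    using U by (intro finite.insertI finite_UN_I finite_imageI) auto
  have "cut R t k \<in> insert (\<lambda>_. -\<infinity>) (\<Union>C\<in>Pow ?U. ?c C ` ?S C)" for k
  proof (cases "k = 0")
    case True
    then show ?thesis using iteration_0[OF t] by simp
  next
    case False
    have "cut_functions P R (Suc t) (k - 1) \<in> Pow ?U" by blast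
    moreover have "1 \<le> k" using False by simp
    ultimately show ?thesis using cut_cases[OF _ t, of k] by blast
  qed
  then have "range (cut R t) \<subseteq> insert (\<lambda>_. -\<infinity>) (\<Union>C\<in>Pow ?U. ?c C ` ?S C)"
    by (rule image_subsetI)
  then have "finite (range (cut R t))" using fin by (rule finite_subset)
  moreover have "(\<Union>k. cut_functions P R t k) \<subseteq> range (cut R t)"
    using t by (auto simp: cut_functions_def)
  ultimately show ?case by (rule rev_finite_subset)
qed

lemma finite_range_cut_functions:
  assumes "t \<in> {2..Suc (stages P)}"
  shows "finite (range (cut_functions P R t))"
proof (rule finite_subset)
  show "range (cut_functions P R t) \<subseteq> Pow (\<Union>k. cut_functions P R t k)" by blast
  show "finite (Pow (\<Union>k. cut_functions P R t k))" using finite_cut_functions[of t] assms by simp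
qed

lemma finite_range_approx:
  assumes "t \<in> {2..Suc (stages P)}"
  shows "finite (range (approx R t))"
proof -
  have "range (approx R t) = max_of_cuts ` range (cut_functions P R t)"
    by (auto simp: approx_eq_max[OF assms])
  then show ?thesis using finite_range_cut_functions[OF assms] by simp
qed

text \<open>Forward induction: finitely many previous trial points and finitely many costs-to-go
  give finitely many subproblems, each with finitely many vertices. Iteration 0 is left out because
  a run does not prescribe its trial points.\<close>

lemma finite_trials: "t \<le> stages P \<Longrightarrow> finite (trial R t ` {1..})"
proof (induction t)
  case 0
  have "trial R 0 ` {1..} \<subseteq> {x_init P}" using trial_0 by auto
  then show ?case by (rule finite_subset) simp
next
  case (Suc t)
  let ?C = "range (cut_functions P R (Suc (Suc t)))"
  have range: "Suc (Suc t) \<in> {2..Suc (stages P)}" using Suc.prems by simp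
  have "finite {x. primal_vertex P (Suc t) (max_of_cuts C) y x}" if "C \<in> ?C" for C y
    using that cut_functions_finite_nonempty[OF range] cut_functions_affine[OF range] Suc.prems
    by (intro finite_primal_vertices polyhedral) auto
  then have fin: "finite (\<Union>C\<in>?C. \<Union>y\<in>trial R t ` {1..}. {x. primal_vertex P (Suc t) (max_of_cuts C) y x})"
    using finite_range_cut_functions[OF range] Suc by (intro finite_UN_I) auto
  have "primal_vertex P (Suc t) (max_of_cuts (cut_functions P R (Suc (Suc t)) (k - 1)))
      (trial R t k) (trial R (Suc t) k)" if "1 \<le> k" for k
  proof -
    have "Suc t \<in> {1..stages P}" using Suc.prems by simp
    then show ?thesis
      using vertices that unfolding vertex_solutions_def approx_eq_max[OF range, symmetric]
      by fastforce
  qed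
  then show ?case by (intro finite_subset[OF _ fin]) fastforce
qed

section \<open>Stabilization of the approximations\<close>

lemma approx_eventually_constant:
  assumes t: "t \<in> {2..stages P}"
  shows "\<exists>M\<ge>1. \<forall>k\<ge>M. approx R t k = approx R t M"
proof -
  let ?X = "trial R (t - 1) ` {1..}"
  have "finite ?X" using finite_trials[of "t - 1"] t by auto
  \<comment> \<open>Finitely many iterations already visit all trial points; \<open>N\<close> is
    chosen so that they are over, and at least 1 because monotonicity starts at iteration 1.\<close>
  then obtain I where I: "I \<subseteq> {1..}" "finite I" "?X = trial R (t - 1) ` I"
    by (metis finite_subset_image order_refl)
  define N where "N = Max (insert 1 I)"
  have N: "1 \<le> N" "I \<subseteq> {1..N}" using I(1,2) by (auto simp: N_def)
  have visited: "\<exists>i\<in>{1..k}. x = trial R (t - 1) i" if x: "x \<in> ?X" and k: "k \<ge> N" for x k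
  proof -
    obtain i where i: "i \<in> I" "x = trial R (t - 1) i" using x unfolding I(3) by blast
    moreover have "i \<in> {1..k}" using subsetD[OF N(2) i(1)] k by simp
    ultimately show ?thesis by blast
  qed
  \<comment> \<open>The approximation is monotone only at trial points; the value 0 elsewhere makes
    \<open>f\<close> monotone as a function.\<close>
  define f where "f k = (\<lambda>x. if x \<in> ?X then approx R t k x else 0)" for k
  have "range f = (\<lambda>\<phi> x. if x \<in> ?X then \<phi> x else 0) ` range (approx R t)"
    by (simp add: f_def[abs_def] image_image)
  then have "finite (range f)" using finite_range_approx[of t] t by simp
  moreover have "f k \<le> f (Suc k)" if "k \<ge> N" for k
  proof (rule le_funI)
    fix x
    show "f k x \<le> f (Suc k) x"
    proof (cases "x \<in> ?X")
      case True
      then obtain i where "i \<in> {1..k}" "x = trial R (t - 1) i" using visited \<open>k \<ge> N\<close> by blast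
      then show ?thesis using approx_mono[of k t i] N(1) \<open>k \<ge> N\<close> t True by (simp add: f_def)
    qed (simp add: f_def)
  qed
  ultimately obtain M where M: "M \<ge> N" "\<And>k. k \<ge> M \<Longrightarrow> f k = f M"
    using eventually_constant_of_finite_range by metis
  have eq: "approx R t (Suc k) (trial R (t - 1) i) = approx R t k (trial R (t - 1) i)"
    if k: "k \<ge> M" and i: "i \<in> {1..k}" for k i
  proof -
    have "trial R (t - 1) i \<in> ?X" using i by simp
    moreover have "f (Suc k) (trial R (t - 1) i) = f k (trial R (t - 1) i)"
      using M(2)[of k] M(2)[of "Suc k"] k by simp
    ultimately show ?thesis by (simp add: f_def)
  qed
  \<comment> \<open>Second stabilization: constant values at the trial points do not yet fix the
    functions, but now the sets of selected cuts increase and take finitely many values.\<close>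
  have "cut_functions P R t k \<subseteq> cut_functions P R t (Suc k)" if "k \<ge> M" for k
    using sel_mono[of k t] eq[OF that] that M(1) N(1) t by (auto simp: cut_functions_def)
  then obtain K where "K \<ge> M" "\<And>k. k \<ge> K \<Longrightarrow> cut_functions P R t k = cut_functions P R t K"
    using eventually_constant_of_finite_range[of M "cut_functions P R t"]
      finite_range_cut_functions[of t] t by auto
  moreover from this have "1 \<le> K" using M(1) N(1) by simp
  moreover have "t \<in> {2..Suc (stages P)}" using t by simp
  ultimately show ?thesis using approx_eq_max by metis
qed

lemma approx_uniformly_eventually_constant:
  "\<exists>M. \<forall>k\<ge>M. \<forall>t\<in>{2..stages P}. approx R t k = approx R t M"
proof -
  obtain m where m: "\<And>t k. t \<in> {2..stages P} \<Longrightarrow> k \<ge> m t \<Longrightarrow> approx R t k = approx R t (m t)"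
    using approx_eventually_constant by metis
  have "m t \<le> Max (m ` {2..stages P})" if "t \<in> {2..stages P}" for t
    using that by simp
  then show ?thesis using m by (metis le_trans)
qed

end

theorem theorem6p1:
  fixes P :: "('n::finite) lp_data" and R :: "'n ddp_seq"
    and F :: "nat \<Rightarrow> ((real ^ 'n) \<times> real) set" and strategy :: selection_strategy
  assumes "1 \<le> stages P"
    and "X_set P 0 = {x_init P}"
    and "\<And>t. t \<in> {1..stages P} \<Longrightarrow> polytope (X_set P t) \<and> X_set P t \<noteq> {}"
    and "\<And>t. t \<in> {1..stages P} \<Longrightarrow>
           finite (F t) \<and> X_set P t = {x. \<forall>(g, h)\<in>F t. g \<bullet> x \<le> h}"
    and "\<And>t y. t \<in> {1..stages P} \<Longrightarrow> y \<in> X_set P (t - 1) \<Longrightarrow>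
           \<exists>x\<in>X_set P t. \<forall>i<nrows P t. A_row P t i \<bullet> x + B_row P t i \<bullet> y = b_rhs P t i"
    and "ddp_run P strategy R"
    and H3: "vertex_solutions P F R"
  shows "\<exists>k0\<ge>1.
           (\<forall>k\<ge>k0 - 1. \<forall>t\<in>{2..stages P}. approx R t k = approx R t (k0 - 1)) \<and>
           lp_optimal P (\<lambda>t. trial R t k0)"
proof -
  interpret ddp_vertex P strategy R F
  proof
    show "ddp_run P strategy R" "vertex_solutions P F R" by fact+
    show "polyhedron (X_set P t)" "finite (F t)" if "t \<in> {1..stages P}" for t
      using assms(3,4)[OF that] by (simp_all add: polytope_imp_polyhedron)
  qed
  obtain M where M: "\<And>k t. k \<ge> M \<Longrightarrow> t \<in> {2..stages P} \<Longrightarrow> approx R t k = approx R t M"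
    using approx_uniformly_eventually_constant by blast
  \<comment> \<open>With \<open>k0 = Suc M\<close>, the forward pass of iteration \<open>k0\<close>
    uses the approximations of iteration \<open>M\<close>, which are already final.\<close>
  have "lp_optimal P (\<lambda>t. trial R t (Suc M))"
  proof (rule trial_lp_optimal)
    show "approx R t (Suc M) = approx R t (Suc M - 1)" if "t \<in> {2..stages P}" for t
      using M[OF _ that, of "Suc M"] by simp
  qed (use assms(1) in simp_all)
  moreover have "\<forall>k\<ge>Suc M - 1. \<forall>t\<in>{2..stages P}. approx R t k = approx R t (Suc M - 1)"
    using M unfolding diff_Suc_1 by blast
  moreover have "1 \<le> Suc M" by simp
  ultimately show ?thesis by blast
qed

end
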